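(* Let $K$ be a field and $S=K[x_1,\ldots,x_n]$. Let $J_1,J_2,J_3\subseteq[n]$ be such that $J_1\cap J_3=\emptyset$. Then for any positive integers $a_1\geq a_2\geq a_3$, the ideal $$I=\mathfrak{m}_{J_1}^{a_1}\cap \mathfrak{m}_{J_2}^{a_2}\cap \mathfrak{m}_{J_3}^{a_3}\subset S$$ is weakly polymatroidal, that is, there exists a total order on the variables $x_1,\ldots,x_n$ with respect to which $I$ is weakly polymatroidal.
   Context: $[n]=\{1,\ldots,n\}$. For $J\subseteq[n]$, $\mathfrak{m}_J$ denotes the ideal of $S$ generated by the variables $x_i$ with $i\in J$. For a monomial ideal $I\subset S$, $G(I)$ denotes its unique minimal set of monomial generators. For a monomial $u$, $\deg_{x_i}(u)$ denotes the exponent of $x_i$ in $u$. Pure lexicographic order: given a total order $x_{i_1}>x_{i_2}>\cdots>x_{i_n}$ of the variables and monomials $u,v\in S$, one writes $u>_{\mathrm{lex}}v$ if there is $t$ such that $\deg_{x_{i_k}}(u)=\deg_{x_{i_k}}(v)$ for all $k=1,\ldots,t-1$ and $\deg_{x_{i_t}}(u)>\deg_{x_{i_t}}(v)$. (Monomials of different total degree are compared by the same rule.) Weakly polymatroidal: a monomial ideal $I\subset S$ (not necessarily generated in a single degree) is weakly polymatroidal with respect to the total order $x_{i_1}>\cdots>x_{i_n}$ if for every two monomials $u,v\in G(I)$ with $u>_{\mathrm{lex}}v$, where $\deg_{x_{i_k}}(u)=\deg_{x_{i_k}}(v)$ for $k=1,\ldots,t-1$ and $\deg_{x_{i_t}}(u)>\deg_{x_{i_t}}(v)$,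 there exists $j>t$ such that $x_{i_j}$ divides $v$ and $x_{i_t}(v/x_{i_j})\in I$. *)

theory Defs
  imports "HOL-Library.Poly_Mapping" "HOL-Algebra.Ideal_Product"
begin

section \<open>The polynomial ring \<open>K[x\<^sub>1,\<dots>,x\<^sub>n]\<close>\<close>

text \<open>
  A monomial is an exponent vector \<open>u :: nat \<Rightarrow>\<^sub>0 nat\<close> whose support lies in \<open>{1..n}\<close>, so
  \<open>Poly_Mapping.lookup u i\<close> is the degree of \<open>u\<close> in \<open>x\<^sub>i\<close> and the product of monomials is \<open>+\<close>.
  Polynomials are finitely supported coefficient functions on monomials; the ring operations are
  those of \<^class>\<open>comm_ring_1\<close> on \<^type>\<open>poly_mapping\<close>.
\<close>

type_synonym 'k mpoly = "(nat \<Rightarrow>\<^sub>0 nat) \<Rightarrow>\<^sub>0 'k"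

definition monomials :: "nat \<Rightarrow> (nat \<Rightarrow>\<^sub>0 nat) set" where
  "monomials n = {u. Poly_Mapping.keys u \<subseteq> {1..n}}"

definition poly_ring :: "nat \<Rightarrow> ('k::field) mpoly ring" where
  "poly_ring n = \<lparr> carrier = {p. Poly_Mapping.keys p \<subseteq> monomials n},
                   mult = (*), one = 1, zero = 0, add = (+) \<rparr>"

definition monomial :: "(nat \<Rightarrow>\<^sub>0 nat) \<Rightarrow> ('k::field) mpoly" where
  "monomial u = Poly_Mapping.single u 1"

definition var :: "nat \<Rightarrow> ('k::field) mpoly" where
  "var i = monomial (Poly_Mapping.single i 1)"

lemma monomials_zero [simp]: "0 \<in> monomials n"
  by (simp add: monomials_def)

lemma monomials_add: "u \<in> monomials n \<Longrightarrow> v \<in> monomials n \<Longrightarrow> u + v \<in> monomials n"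
  using keys_add[of u v] by (auto simp: monomials_def)

lemma monomials_addD: "u + v \<in> monomials n \<Longrightarrow> u \<in> monomials n \<and> v \<in> monomials n"
  by (auto simp: monomials_def in_keys_iff lookup_add subset_iff)

lemma keys_mult_sum: "m \<in> Poly_Mapping.keys (p * q) \<Longrightarrow> \<exists>a\<in>Poly_Mapping.keys p. \<exists>b\<in>Poly_Mapping.keys q. m = a + b"
  using keys_mult[of p q] by blast

lemma poly_ring_mult_closed:
  "Poly_Mapping.keys p \<subseteq> monomials n \<Longrightarrow> Poly_Mapping.keys q \<subseteq> monomials n \<Longrightarrow> Poly_Mapping.keys (p * q) \<subseteq> monomials n"
  using keys_mult[of p q] monomials_add by fast

lemma poly_ring_cring: "cring (poly_ring n)"
proof (rule cringI)
  show "abelian_group (poly_ring n :: 'a mpoly ring)"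
  proof (rule abelian_groupI)
    fix p :: "'a mpoly"
    assume "p \<in> carrier (poly_ring n)"
    then show "\<exists>q\<in>carrier (poly_ring n). q \<oplus>\<^bsub>poly_ring n\<^esub> p = \<zero>\<^bsub>poly_ring n\<^esub>"
      by (intro bexI[of _ "- p"]) (auto simp: poly_ring_def)
  next
    fix p q :: "'a mpoly"
    assume "p \<in> carrier (poly_ring n)" "q \<in> carrier (poly_ring n)"
    then show "p \<oplus>\<^bsub>poly_ring n\<^esub> q \<in> carrier (poly_ring n)"
      using keys_add[of p q] by (auto simp: poly_ring_def)
  qed (auto simp: poly_ring_def add.assoc add.commute)
  show "Group.comm_monoid (poly_ring n :: 'a mpoly ring)"
    by (rule comm_monoidI) (simp_all add: poly_ring_def mult.assoc mult.commute poly_ring_mult_closed)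
qed (simp add: poly_ring_def distrib_right)

section \<open>Monomial ideals and their minimal generators\<close>

definition monomial_ideal :: "nat \<Rightarrow> ('k::field) mpoly set \<Rightarrow> bool" where
  "monomial_ideal n I \<longleftrightarrow> (\<exists>M \<subseteq> monomials n. I = Idl\<^bsub>poly_ring n\<^esub> (monomial ` M))"

definition is_min_gens ::
    "nat \<Rightarrow> ('k::field) mpoly set \<Rightarrow> (nat \<Rightarrow>\<^sub>0 nat) set \<Rightarrow> bool" where
  "is_min_gens n I M \<longleftrightarrow>
     M \<subseteq> monomials n \<and> I = Idl\<^bsub>poly_ring n\<^esub> (monomial ` M) \<and>
     (\<forall>M'. M' \<subset> M \<longrightarrow> I \<noteq> Idl\<^bsub>poly_ring n\<^esub> (monomial ` M'))"

text \<open>\<open>G(I)\<close>; well defined for monomial ideals by \<open>ex1_min_gens\<close> below.\<close>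

definition min_gens :: "nat \<Rightarrow> ('k::field) mpoly set \<Rightarrow> (nat \<Rightarrow>\<^sub>0 nat) set" where
  "min_gens n I = (THE M. is_min_gens n I M)"

lemma monomial_dvd_refl: "u \<in> M \<Longrightarrow> \<exists>v\<in>M. \<exists>w. u = v + (w :: nat \<Rightarrow>\<^sub>0 nat)"
  by (metis add.right_neutral)

lemma monomial_mem_genideal_iff:
  assumes M: "M \<subseteq> monomials n"
  shows "monomial m \<in> Idl\<^bsub>poly_ring n\<^esub> (monomial ` M :: ('k::field) mpoly set)
         \<longleftrightarrow> m \<in> monomials n \<and> (\<exists>u\<in>M. \<exists>w. m = u + w)"
    (is "?L \<longleftrightarrow> ?R")
proof -
  let ?S = "poly_ring n :: 'k mpoly ring"
  interpret cring ?S by (rule poly_ring_cring)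
  let ?T = "{p \<in> carrier ?S. \<forall>m\<in>Poly_Mapping.keys p. \<exists>u\<in>M. \<exists>w. m = u + w}"
  have mult: "p * q \<in> ?T" if "p \<in> ?T" "q \<in> carrier ?S" for p q
  proof -
    have "\<exists>u\<in>M. \<exists>w. m = u + w" if m: "m \<in> Poly_Mapping.keys (p * q)" for m
    proof -
      obtain a b where ab: "a \<in> Poly_Mapping.keys p" "m = a + b"
        using keys_mult_sum[OF m] by blast
      then show ?thesis
        using \<open>p \<in> ?T\<close> by (force simp: add.assoc)
    qed
    then show ?thesis
      using that poly_ring_mult_closed[of p n q] by (auto simp: poly_ring_def)
  qed
  have ideal: "ideal ?T ?S"
  proof (rule idealI[OF ring_axioms])
    show "subgroup ?T (add_monoid ?S)"
    proof (rule add.subgroupI)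
      show "?T \<subseteq> carrier ?S" by blast
      show "?T \<noteq> {}" by (auto simp: poly_ring_def intro!: exI[of _ 0])
    next
      fix p assume p: "p \<in> ?T"
      then have "- p = \<ominus>\<^bsub>?S\<^esub> p"
        by (intro sum_zero_eq_neg) (auto simp: poly_ring_def)
      then show "\<ominus>\<^bsub>?S\<^esub> p \<in> ?T"
        using p unfolding \<open>- p = _\<close>[symmetric] by (auto simp: poly_ring_def)
    next
      fix p q assume "p \<in> ?T" "q \<in> ?T"
      then show "p \<oplus>\<^bsub>?S\<^esub> q \<in> ?T"
        using keys_add[of p q] by (auto simp: poly_ring_def)
    qed
  next
    fix p q assume "p \<in> ?T" "q \<in> carrier ?S"
    then have "p * q \<in> ?T" by (rule mult)
    then show "p \<otimes>\<^bsub>?S\<^esub> q \<in> ?T" "q \<otimes>\<^bsub>?S\<^esub> p \<in> ?T"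
      by (simp_all add: poly_ring_def mult.commute)
  qed
  have sub: "monomial ` M \<subseteq> carrier ?S"
    using M by (auto simp: poly_ring_def monomial_def)
  have "monomial ` M \<subseteq> ?T"
    using M by (auto simp: poly_ring_def monomial_def monomial_dvd_refl)
  then have "Idl\<^bsub>?S\<^esub> (monomial ` M) \<subseteq> ?T"
    by (rule genideal_minimal[OF ideal])
  then have LR: "?L \<Longrightarrow> ?R"
    by (auto simp: monomial_def poly_ring_def)
  have "?L" if "?R"
  proof -
    from that obtain u w where uw: "u \<in> M" "m = u + w" "w \<in> monomials n"
      using monomials_addD by blast
    have "monomial u \<in> Idl\<^bsub>?S\<^esub> (monomial ` M)"
      using genideal_self[OF sub] uw(1) by blast
    moreover have "monomial w \<in> carrier ?S"
      using uw by (simp add: poly_ring_def monomial_def)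
    ultimately have "monomial u \<otimes>\<^bsub>?S\<^esub> monomial w \<in> Idl\<^bsub>?S\<^esub> (monomial ` M)"
      by (rule ideal.I_r_closed[OF genideal_ideal[OF sub]])
    then show ?L
      by (simp add: poly_ring_def monomial_def mult_single uw)
  qed
  with LR show ?thesis by blast
qed

lemma genideal_monomial_subset:
  assumes "M \<subseteq> monomials n" "N \<subseteq> monomials n" "\<And>u. u \<in> M \<Longrightarrow> \<exists>v\<in>N. \<exists>w. u = v + w"
  shows "Idl\<^bsub>poly_ring n\<^esub> (monomial ` M :: ('k::field) mpoly set) \<subseteq> Idl\<^bsub>poly_ring n\<^esub> (monomial ` N)"
proof -
  interpret cring "poly_ring n :: 'k mpoly ring" by (rule poly_ring_cring)
  have "monomial ` N \<subseteq> carrier (poly_ring n :: 'k mpoly ring)"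
    using assms(2) by (auto simp: poly_ring_def monomial_def)
  moreover have "monomial ` M \<subseteq> Idl\<^bsub>poly_ring n\<^esub> (monomial ` N :: 'k mpoly set)"
    using assms by (auto simp: monomial_mem_genideal_iff)
  ultimately show ?thesis
    by (intro genideal_minimal genideal_ideal)
qed

lemma monomial_antisym:
  fixes u v w w' :: "nat \<Rightarrow>\<^sub>0 nat"
  assumes "u = v + w" "v = u + w'"
  shows "u = v"
proof (rule poly_mapping_eqI)
  fix k
  have "Poly_Mapping.lookup u k = Poly_Mapping.lookup v k + Poly_Mapping.lookup w k" "Poly_Mapping.lookup v k = Poly_Mapping.lookup u k + Poly_Mapping.lookup w' k"
    using assms by (metis lookup_add)+
  then show "Poly_Mapping.lookup u k = Poly_Mapping.lookup v k" by simp
qed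

lemma min_gens_subset:
  fixes I :: "('k::field) mpoly set"
  assumes M: "is_min_gens n I M" and N: "is_min_gens n I N"
  shows "M \<subseteq> N"
proof
  fix u assume u: "u \<in> M"
  have Mn: "M \<subseteq> monomials n" and Nn: "N \<subseteq> monomials n"
    and IM: "I = Idl\<^bsub>poly_ring n\<^esub> (monomial ` M)" and IN: "I = Idl\<^bsub>poly_ring n\<^esub> (monomial ` N)"
    using M N by (auto simp: is_min_gens_def)
  have "monomial u \<in> I"
    using u Mn by (auto simp: IM monomial_mem_genideal_iff[OF Mn] monomial_dvd_refl)
  then obtain v w where v: "v \<in> N" "u = v + w"
    unfolding IN using Nn by (auto simp: monomial_mem_genideal_iff)
  have "monomial v \<in> I"
    using v(1) Nn by (auto simp: IN monomial_mem_genideal_iff[OF Nn] monomial_dvd_refl)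
  then obtain u' w' where u': "u' \<in> M" "v = u' + w'"
    unfolding IM using Mn by (auto simp: monomial_mem_genideal_iff)
  have "u' = u"
  proof (rule ccontr)
    assume ne: "u' \<noteq> u"
    have "I = Idl\<^bsub>poly_ring n\<^esub> (monomial ` (M - {u}))"
    proof
      show "I \<subseteq> Idl\<^bsub>poly_ring n\<^esub> (monomial ` (M - {u}))"
        unfolding IM
      proof (rule genideal_monomial_subset)
        fix x assume "x \<in> M"
        show "\<exists>y\<in>M - {u}. \<exists>w. x = y + w"
        proof (cases "x = u")
          case True
          then show ?thesis
            using v u' ne by (intro bexI[of _ u'] exI[of _ "w' + w"]) (auto simp: add.assoc)
        next
          case False
          then show ?thesis using \<open>x \<in> M\<close> by (intro bexI[of _ x] exI[of _ 0]) auto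
        qed
      qed (use Mn in auto)
      show "Idl\<^bsub>poly_ring n\<^esub> (monomial ` (M - {u})) \<subseteq> I"
        unfolding IM using Mn
        by (intro genideal_monomial_subset) (auto intro: monomial_dvd_refl)
    qed
    moreover have "M - {u} \<subset> M" using u by blast
    ultimately show False using M by (auto simp: is_min_gens_def)
  qed
  then have "u = v" using monomial_antisym v u' by blast
  with v show "u \<in> N" by simp
qed

theorem ex1_min_gens:
  fixes I :: "('k::field) mpoly set"
  assumes "monomial_ideal n I"
  shows "\<exists>!M. is_min_gens n I M"
proof -
  obtain M where M: "M \<subseteq> monomials n" "I = Idl\<^bsub>poly_ring n\<^esub> (monomial ` M)"
    using assms by (auto simp: monomial_ideal_def)
  define N where "N = {u\<in>M. \<forall>v\<in>M. \<forall>w. u = v + w \<longrightarrow> v = u}"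
  have N: "N \<subseteq> M" "N \<subseteq> monomials n" using M by (auto simp: N_def)
  let ?d = "\<lambda>u::nat \<Rightarrow>\<^sub>0 nat. \<Sum>i\<in>{1..n}. Poly_Mapping.lookup u i"
  have ex: "\<exists>v\<in>N. \<exists>w. u = v + w" if "u \<in> M" for u
    using that
  proof (induction "?d u" arbitrary: u rule: less_induct)
    case less
    show ?case
    proof (cases "u \<in> N")
      case True
      then show ?thesis by (intro bexI[of _ u] exI[of _ 0]) auto
    next
      case False
      then obtain v w where v: "v \<in> M" "u = v + w" "v \<noteq> u"
        using less.prems by (auto simp: N_def)
      then have "w \<noteq> 0" by auto
      then obtain i where "i \<in> Poly_Mapping.keys w"
        by (metis in_keys_iff lookup_zero poly_mapping_eqI)
      moreover have "w \<in> monomials n"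
        using v less.prems M monomials_addD by blast
      ultimately have "i \<in> {1..n}" "0 < Poly_Mapping.lookup w i"
        by (auto simp: monomials_def in_keys_iff subset_iff)
      then have "0 < ?d w" by (intro sum_pos2[of _ i]) auto
      then have "?d v < ?d u" by (simp add: v lookup_add sum.distrib)
      from less.hyps[OF this v(1)] show ?thesis
        using v by (metis add.assoc)
    qed
  qed
  have "is_min_gens n I N"
    unfolding is_min_gens_def
  proof (intro conjI allI impI notI)
    show "I = Idl\<^bsub>poly_ring n\<^esub> (monomial ` N)"
      unfolding M(2)
    proof
      show "Idl\<^bsub>poly_ring n\<^esub> (monomial ` N :: 'k mpoly set) \<subseteq> Idl\<^bsub>poly_ring n\<^esub> (monomial ` M)"
        using N M by (intro genideal_monomial_subset) (auto intro: monomial_dvd_refl)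
    qed (use genideal_monomial_subset[OF M(1) N(2) ex] in simp)
  next
    fix N' assume N': "N' \<subset> N" "I = Idl\<^bsub>poly_ring n\<^esub> (monomial ` N')"
    then obtain u where u: "u \<in> N" "u \<notin> N'" by blast
    then have "monomial u \<in> I"
      using M(1) N by (auto simp: M(2) monomial_mem_genideal_iff[OF M(1)] intro!: monomial_dvd_refl)
    then obtain v w where v: "v \<in> N'" "u = v + w"
      unfolding N'(2) using N' N by (subst (asm) monomial_mem_genideal_iff) auto
    then have "v \<in> M" using N' N by blast
    then have "v = u" using u(1) v(2) by (simp add: N_def)
    then show False using u(2) v(1) by simp
  qed (use N in auto)
  then show ?thesis using min_gens_subset by blast
qed

text \<open>The ideal written \<open>\<mm>\<^sub>J\<close> in the literature.\<close>

definition var_ideal :: "nat \<Rightarrow> nat set \<Rightarrow> ('k::field) mpoly set" where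
  "var_ideal n J = Idl\<^bsub>poly_ring n\<^esub> (var ` J)"

text \<open>
  Ideal powers are powers in the monoid of ideals of \<^term>\<open>poly_ring n\<close> under \<^const>\<open>ideal_prod\<close>.
\<close>

abbreviation ideal_power ::
    "nat \<Rightarrow> ('k::field) mpoly set \<Rightarrow> nat \<Rightarrow> 'k mpoly set" where
  "ideal_power n I a \<equiv> I [^]\<^bsub>ideals_set (poly_ring n)\<^esub> a"

section \<open>Weakly polymatroidal ideals\<close>

text \<open>
  A total order \<open>x\<^bsub>i 1\<^esub> > \<dots> > x\<^bsub>i n\<^esub>\<close> of the variables is given by a bijection \<open>i\<close> of \<open>{1..n}\<close>.
  The predicate \<open>lex_gt_at n i t u v\<close> states that \<open>u\<close> exceeds \<open>v\<close> in the corresponding pure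
  lexicographic order and that \<open>t\<close> is the first position where they differ.
\<close>

definition lex_gt_at ::
    "nat \<Rightarrow> (nat \<Rightarrow> nat) \<Rightarrow> nat \<Rightarrow> (nat \<Rightarrow>\<^sub>0 nat) \<Rightarrow> (nat \<Rightarrow>\<^sub>0 nat) \<Rightarrow> bool" where
  "lex_gt_at n i t u v \<longleftrightarrow>
     t \<in> {1..n} \<and>
     (\<forall>k\<in>{1..<t}. Poly_Mapping.lookup u (i k) = Poly_Mapping.lookup v (i k)) \<and>
     Poly_Mapping.lookup u (i t) > Poly_Mapping.lookup v (i t)"

text \<open>
  The subtraction of exponent vectors below is the exact quotient of \<open>v\<close> by the variable with
  index \<open>i j\<close>, as that variable is required to divide \<open>v\<close>.
\<close>

definition weakly_polymatroidal ::
    "nat \<Rightarrow> (nat \<Rightarrow> nat) \<Rightarrow> ('k::field) mpoly set \<Rightarrow> bool" where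
  "weakly_polymatroidal n i I \<longleftrightarrow>
     monomial_ideal n I \<and>
     (\<forall>u \<in> min_gens n I. \<forall>v \<in> min_gens n I. \<forall>t. lex_gt_at n i t u v \<longrightarrow>
        (\<exists>j\<in>{t<..n}. 0 < Poly_Mapping.lookup v (i j) \<and>
           var (i t) * monomial (v - Poly_Mapping.single (i j) 1) \<in> I))"

end

theory Submission
  imports Defs
begin

text \<open>
  The ideal \<open>\<mm>\<^sub>J\<^sup>a\<close> consists of the polynomials all of whose monomials have degree at least \<open>a\<close> in
  the variables of \<open>J\<close> (\<open>ideal_power_var_ideal\<close>). So \<open>I\<close> is determined by the monomials
  satisfying the three inequalities \<open>deg\<^sub>J\<^sub>c \<ge> a\<^sub>c\<close>, and everything reduces to moving one unit of
  exponent from a variable \<open>y\<close> to a variable \<open>x\<close>. The move stays inside \<open>I\<close> as soon as every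
  \<open>J\<^sub>c\<close> that contains \<open>y\<close> also contains \<open>x\<close> (\<open>degree_in_exchange\<close>). This suggests putting first
  the variables that lie in several of the sets: first those in \<open>J\<^sub>1 \<inter> J\<^sub>2\<close>, then those in
  \<open>J\<^sub>2 \<inter> J\<^sub>3\<close>, then all others in any order.

  Now let \<open>u\<close> and \<open>v\<close> be minimal generators that first differ at \<open>x\<close>, with the larger exponent
  in \<open>u\<close>. As \<open>u\<close> cannot be divided by \<open>x\<close> inside \<open>I\<close>, some inequality with \<open>x \<in> J\<^sub>c\<close> is an
  equality for \<open>u\<close>. The monomial \<open>v\<close> satisfies the same inequality, so \<open>v\<close> must make up for its
  deficit at \<open>x\<close> by a larger exponent at another \<open>y \<in> J\<^sub>c\<close>, and this \<open>y\<close> comes after \<open>x\<close>.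
  Because of the chosen order, \<open>y\<close> then lies in no \<open>J\<^sub>d\<close> that misses \<open>x\<close>, so that \<open>y\<close> can be
  exchanged for \<open>x\<close>.

  The only exception is \<open>x \<in> J\<^sub>1 \<inter> J\<^sub>2\<close> with equality for \<open>J\<^sub>2\<close> alone, where \<open>y\<close> might lie in \<open>J\<^sub>3\<close>.
  There any later \<open>y \<in> J\<^sub>1\<close> dividing \<open>v\<close> serves, and one exists because otherwise
  \<open>deg\<^sub>J\<^sub>1 v < deg\<^sub>J\<^sub>2 u = a\<^sub>2 \<le> a\<^sub>1\<close>. This combinatorial core is
  \<open>exchange_variable_exists\<close>.
\<close>

section \<open>Ideals spanned by monomials\<close>

definition monomial_filter :: "nat \<Rightarrow> (nat \<Rightarrow>\<^sub>0 nat) set \<Rightarrow> bool" where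
  "monomial_filter n U \<longleftrightarrow> U \<subseteq> monomials n \<and> (\<forall>u\<in>U. \<forall>w\<in>monomials n. u + w \<in> U)"

text \<open>
  The linear span of a set of monomials, which for a filter is also the ideal generated by it.
  Working with spans makes intersections of ideals intersections of sets of monomials.
\<close>

definition monomial_span :: "(nat \<Rightarrow>\<^sub>0 nat) set \<Rightarrow> ('k::field) mpoly set" where
  "monomial_span U = {p. Poly_Mapping.keys p \<subseteq> U}"

lemma monomial_in_span_iff [simp]: "(monomial m :: ('k::field) mpoly) \<in> monomial_span U \<longleftrightarrow> m \<in> U"
  by (simp add: monomial_span_def monomial_def)

lemma monomial_span_ideal:
  assumes U: "monomial_filter n U"
  shows "ideal (monomial_span U :: ('k::field) mpoly set) (poly_ring n)"
proof -
  let ?S = "poly_ring n :: 'k mpoly ring" and ?T = "monomial_span U :: 'k mpoly set"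
  interpret cring ?S by (rule poly_ring_cring)
  have sub: "?T \<subseteq> carrier ?S"
    using U by (auto simp: monomial_span_def poly_ring_def monomial_filter_def)
  have mult: "p * q \<in> ?T" if "p \<in> ?T" "q \<in> carrier ?S" for p q
  proof -
    have "m \<in> U" if m: "m \<in> Poly_Mapping.keys (p * q)" for m
    proof -
      obtain a b where "a \<in> Poly_Mapping.keys p" "b \<in> Poly_Mapping.keys q" "m = a + b"
        using keys_mult_sum[OF m] by blast
      then show ?thesis
        using U \<open>p \<in> ?T\<close> \<open>q \<in> carrier ?S\<close>
        by (simp add: monomial_filter_def monomial_span_def poly_ring_def subset_iff)
    qed
    then show ?thesis by (auto simp: monomial_span_def)
  qed
  show ?thesis
  proof (rule idealI[OF ring_axioms])
    show "subgroup ?T (add_monoid ?S)"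
    proof (rule add.subgroupI)
      show "?T \<subseteq> carrier ?S" by (rule sub)
      show "?T \<noteq> {}" by (auto simp: monomial_span_def intro!: exI[of _ 0])
    next
      fix p assume p: "p \<in> ?T"
      then have "- p = \<ominus>\<^bsub>?S\<^esub> p"
        using sub by (intro sum_zero_eq_neg) (auto simp: poly_ring_def)
      then show "\<ominus>\<^bsub>?S\<^esub> p \<in> ?T"
        using p unfolding \<open>- p = _\<close>[symmetric] by (auto simp: monomial_span_def)
    next
      fix p q assume "p \<in> ?T" "q \<in> ?T"
      then show "p \<oplus>\<^bsub>?S\<^esub> q \<in> ?T"
        using keys_add[of p q] by (auto simp: poly_ring_def monomial_span_def)
    qed
  next
    fix p q assume "p \<in> ?T" "q \<in> carrier ?S"
    then have "p * q \<in> ?T" by (rule mult)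
    then show "p \<otimes>\<^bsub>?S\<^esub> q \<in> ?T" "q \<otimes>\<^bsub>?S\<^esub> p \<in> ?T"
      by (simp_all add: poly_ring_def mult.commute)
  qed
qed

text \<open>
  A polynomial is the sum of its terms, and each term is a constant multiple of a monomial. The
  proof splits off the terms one by one.
\<close>

lemma monomial_span_subset_ideal:
  fixes T :: "('k::field) mpoly set"
  assumes T: "ideal T (poly_ring n)" and U: "\<And>m. m \<in> U \<Longrightarrow> monomial m \<in> T"
  shows "monomial_span U \<subseteq> T"
proof
  interpret ideal T "poly_ring n" by (rule T)
  have "p \<in> T" if "finite A" "Poly_Mapping.keys p \<subseteq> A" "A \<subseteq> U" for A and p :: "'k mpoly"
    using that
  proof (induction A arbitrary: p rule: finite_induct)
    case empty
    then show ?case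
      using additive_subgroup.zero_closed[OF ideal.axioms(1)[OF T]] by (simp add: poly_ring_def)
  next
    case (insert m A)
    let ?s = "Poly_Mapping.single m (Poly_Mapping.lookup p m)"
    let ?q = "p - ?s"
    have "Poly_Mapping.keys ?q \<subseteq> A"
      using insert.prems by (auto simp: in_keys_iff lookup_minus lookup_single when_def split: if_splits)
    then have q: "?q \<in> T" using insert by simp
    have "Poly_Mapping.single 0 (Poly_Mapping.lookup p m) \<in> carrier (poly_ring n :: 'k mpoly ring)"
      by (simp add: poly_ring_def)
    then have "Poly_Mapping.single 0 (Poly_Mapping.lookup p m) \<otimes>\<^bsub>poly_ring n\<^esub> monomial m \<in> T"
      using U insert.prems by (intro I_l_closed) auto
    then have "?s \<in> T" by (simp add: poly_ring_def monomial_def mult_single)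
    then have "?q \<oplus>\<^bsub>poly_ring n\<^esub> ?s \<in> T" using q
      by (intro additive_subgroup.a_closed[OF ideal.axioms(1)[OF T]])
    then show ?case by (simp add: poly_ring_def)
  qed
  from this[of "Poly_Mapping.keys p" p for p] show "p \<in> T" if "p \<in> monomial_span U" for p
    using that by (simp add: monomial_span_def)
qed

lemma monomial_span_eq_genideal:
  assumes U: "monomial_filter n U"
  shows "monomial_span U = Idl\<^bsub>poly_ring n\<^esub> (monomial ` U :: ('k::field) mpoly set)"
proof
  interpret cring "poly_ring n :: 'k mpoly ring" by (rule poly_ring_cring)
  have Un: "U \<subseteq> monomials n" using U by (simp add: monomial_filter_def)
  then have sub: "monomial ` U \<subseteq> carrier (poly_ring n :: 'k mpoly ring)"
    by (auto simp: poly_ring_def monomial_def)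
  show "monomial_span U \<subseteq> Idl\<^bsub>poly_ring n\<^esub> (monomial ` U :: 'k mpoly set)"
    using genideal_self[OF sub] by (intro monomial_span_subset_ideal[OF genideal_ideal[OF sub]]) auto
  show "Idl\<^bsub>poly_ring n\<^esub> (monomial ` U :: 'k mpoly set) \<subseteq> monomial_span U"
    by (intro genideal_minimal monomial_span_ideal[OF U]) auto
qed

lemma monomial_ideal_span: "monomial_filter n U \<Longrightarrow> monomial_ideal n (monomial_span U)"
  unfolding monomial_ideal_def by (metis monomial_filter_def monomial_span_eq_genideal)

lemma remove_variable:
  assumes "0 < Poly_Mapping.lookup u x"
  obtains w where "u = w + Poly_Mapping.single x (1::nat)"
    and "w = u - Poly_Mapping.single x 1"
proof
  show "u = (u - Poly_Mapping.single x 1) + Poly_Mapping.single x 1"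
    using assms by (intro poly_mapping_eqI) (auto simp: lookup_add lookup_minus lookup_single when_def)
qed simp

text \<open>
  If \<open>u / x\<close> were still in the ideal, it would be divisible by a generator \<open>v\<close>; since \<open>v\<close> properly
  divides \<open>u\<close>, the generator \<open>u\<close> would be redundant.
\<close>

lemma min_gens_minimal:
  fixes u :: "nat \<Rightarrow>\<^sub>0 nat"
  assumes U: "monomial_filter n U"
    and u: "u \<in> min_gens n (monomial_span U :: ('k::field) mpoly set)"
  shows "u \<in> U" and "0 < Poly_Mapping.lookup u x \<Longrightarrow> u - Poly_Mapping.single x 1 \<notin> U"
proof -
  let ?I = "monomial_span U :: 'k mpoly set"
  define M where "M = min_gens n ?I"
  have M: "is_min_gens n ?I M"
    unfolding M_def min_gens_def by (rule theI'[OF ex1_min_gens[OF monomial_ideal_span[OF U]]])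
  have Mn: "M \<subseteq> monomials n" and IM: "?I = Idl\<^bsub>poly_ring n\<^esub> (monomial ` M)"
    using M unfolding is_min_gens_def by simp_all
  have irr: "?I \<noteq> Idl\<^bsub>poly_ring n\<^esub> (monomial ` M')" if "M' \<subset> M" for M'
    by (rule M[unfolded is_min_gens_def, THEN conjunct2, THEN conjunct2, rule_format, OF that])
  have U_iff: "m \<in> U \<longleftrightarrow> m \<in> monomials n \<and> (\<exists>v\<in>M. \<exists>w. m = v + w)" for m
    using monomial_mem_genideal_iff[OF Mn, of m, where 'k = 'k] by (simp flip: IM)
  have uM: "u \<in> M" using u by (simp add: M_def)
  then show "u \<in> U" unfolding U_iff using Mn monomial_dvd_refl[OF uM] by auto
  show "u - Poly_Mapping.single x 1 \<notin> U" if x: "0 < Poly_Mapping.lookup u x"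
  proof
    assume "u - Poly_Mapping.single x 1 \<in> U"
    then obtain v w where v: "v \<in> M" "u - Poly_Mapping.single x 1 = v + w"
      using U_iff by blast
    obtain u' where "u = u' + Poly_Mapping.single x 1" "u' = u - Poly_Mapping.single x 1"
      using remove_variable[OF x] .
    then have uv: "u = v + (w + Poly_Mapping.single x 1)"
      using v(2) by (simp add: add.assoc)
    have "v \<noteq> u"
    proof
      assume "v = u"
      then have "w + Poly_Mapping.single x 1 = 0" using uv by simp
      then have "Poly_Mapping.lookup (w + Poly_Mapping.single x 1) x = 0" by simp
      then show False by (simp add: lookup_add)
    qed
    have "?I = Idl\<^bsub>poly_ring n\<^esub> (monomial ` (M - {u}))"
    proof
      show "?I \<subseteq> Idl\<^bsub>poly_ring n\<^esub> (monomial ` (M - {u}))"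
        unfolding IM
      proof (rule genideal_monomial_subset)
        fix m assume "m \<in> M"
        then show "\<exists>v\<in>M - {u}. \<exists>w. m = v + w"
          using v(1) uv \<open>v \<noteq> u\<close> monomial_dvd_refl[of m "M - {u}"] by (cases "m = u") auto
      qed (use Mn in auto)
      show "Idl\<^bsub>poly_ring n\<^esub> (monomial ` (M - {u})) \<subseteq> ?I"
        unfolding IM using Mn
        by (intro genideal_monomial_subset) (auto intro: monomial_dvd_refl)
    qed
    then show False using irr[of "M - {u}"] uM by blast
  qed
qed

section \<open>Powers of monomial prime ideals\<close>

definition degree_in :: "nat set \<Rightarrow> (nat \<Rightarrow>\<^sub>0 nat) \<Rightarrow> nat" where
  "degree_in J u = (\<Sum>j\<in>J. Poly_Mapping.lookup u j)"

definition high_degree :: "nat \<Rightarrow> nat set \<Rightarrow> nat \<Rightarrow> (nat \<Rightarrow>\<^sub>0 nat) set" where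
  "high_degree n J a = {u \<in> monomials n. a \<le> degree_in J u}"

lemma degree_in_add: "degree_in J (u + v) = degree_in J u + degree_in J v"
  by (simp add: degree_in_def lookup_add sum.distrib)

lemma degree_in_single:
  "finite J \<Longrightarrow> degree_in J (Poly_Mapping.single x c) = (if x \<in> J then c else 0)"
  by (simp add: degree_in_def lookup_single when_def)

lemma monomial_filter_high_degree: "monomial_filter n (high_degree n J a)"
  by (auto simp: monomial_filter_def high_degree_def degree_in_add monomials_add)

lemma var_ideal_eq_span:
  assumes J: "J \<subseteq> {1..n}"
  shows "var_ideal n J = (monomial_span (high_degree n J 1) :: ('k::field) mpoly set)"
proof -
  interpret cring "poly_ring n :: 'k mpoly ring" by (rule poly_ring_cring)
  let ?X = "(\<lambda>j. Poly_Mapping.single j 1) ` J :: (nat \<Rightarrow>\<^sub>0 nat) set"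
  have fin: "finite J" using J finite_subset by blast
  have X: "?X \<subseteq> monomials n" using J by (auto simp: monomials_def)
  have I: "var_ideal n J = Idl\<^bsub>poly_ring n\<^esub> (monomial ` ?X :: 'k mpoly set)"
    by (simp add: var_ideal_def var_def image_image)
  have sub: "monomial ` ?X \<subseteq> carrier (poly_ring n :: 'k mpoly ring)"
    using X by (auto simp: poly_ring_def monomial_def)
  show ?thesis
    unfolding I
  proof
    show "Idl\<^bsub>poly_ring n\<^esub> (monomial ` ?X) \<subseteq> (monomial_span (high_degree n J 1) :: 'k mpoly set)"
      using X fin
      by (intro genideal_minimal monomial_span_ideal[OF monomial_filter_high_degree])
         (auto simp: high_degree_def degree_in_single)
    show "(monomial_span (high_degree n J 1) :: 'k mpoly set) \<subseteq> Idl\<^bsub>poly_ring n\<^esub> (monomial ` ?X)"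
    proof (rule monomial_span_subset_ideal[OF genideal_ideal[OF sub]])
      fix m assume m: "m \<in> high_degree n J 1"
      then have "degree_in J m \<noteq> 0" by (simp add: high_degree_def)
      then obtain j where j: "j \<in> J" "0 < Poly_Mapping.lookup m j"
        unfolding degree_in_def by (metis sum.neutral gr0I)
      obtain w where "m = w + Poly_Mapping.single j 1" using remove_variable[OF j(2)] .
      then have "m = Poly_Mapping.single j 1 + w" by (simp add: add.commute)
      then show "monomial m \<in> Idl\<^bsub>poly_ring n\<^esub> (monomial ` ?X :: 'k mpoly set)"
        using m j(1) unfolding monomial_mem_genideal_iff[OF X] by (auto simp: high_degree_def)
    qed
  qed
qed

text \<open>
  A monomial of degree at least \<open>a + 1\<close> in \<open>J\<close> is divisible by a variable of \<open>J\<close>, and the quotient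
  has degree at least \<open>a\<close> there; this is the factorisation behind the induction step.
\<close>

lemma ideal_power_var_ideal:
  assumes J: "J \<subseteq> {1..n}"
  shows "ideal_power n (var_ideal n J) a = (monomial_span (high_degree n J a) :: ('k::field) mpoly set)"
proof (induction a)
  let ?S = "poly_ring n :: 'k mpoly ring"
  case 0
  have "ideal_power n (var_ideal n J :: 'k mpoly set) 0 = carrier ?S"
    by (simp add: nat_pow_def ideals_set_def)
  then show ?case
    by (simp add: poly_ring_def monomial_span_def high_degree_def)
next
  let ?S = "poly_ring n :: 'k mpoly ring"
  interpret cring ?S by (rule poly_ring_cring)
  let ?V = "\<lambda>b. monomial_span (high_degree n J b) :: 'k mpoly set"
  note id = monomial_span_ideal[OF monomial_filter_high_degree]
  have fin: "finite J" using J finite_subset by blast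
  case (Suc a)
  have step: "ideal_power n (var_ideal n J) (Suc a) = ideal_prod ?S (?V a) (?V 1)"
    using Suc by (simp add: nat_pow_def ideals_set_def var_ideal_eq_span[OF J])
  have "ideal_prod ?S (?V a) (?V 1) \<subseteq> ?V (Suc a)"
  proof
    fix p assume "p \<in> ideal_prod ?S (?V a) (?V 1)"
    then show "p \<in> ?V (Suc a)"
    proof induction
      case (prod p q)
      have "m \<in> high_degree n J (Suc a)" if m: "m \<in> Poly_Mapping.keys (p * q)" for m
      proof -
        obtain b c where "b \<in> Poly_Mapping.keys p" "c \<in> Poly_Mapping.keys q" "m = b + c"
          using keys_mult_sum[OF m] by blast
        then have "b \<in> high_degree n J a" "c \<in> high_degree n J 1" "m = b + c"
          using prod by (auto simp: monomial_span_def)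
        then show ?thesis by (auto simp: high_degree_def degree_in_add monomials_add)
      qed
      then show ?case by (auto simp: monomial_span_def poly_ring_def)
    next
      case (sum p q)
      then show ?case
        using additive_subgroup.a_closed[OF ideal.axioms(1)[OF id]] by blast
    qed
  qed
  moreover have "?V (Suc a) \<subseteq> ideal_prod ?S (?V a) (?V 1)"
  proof (rule monomial_span_subset_ideal[OF ideal_prod_is_ideal[OF id id]])
    fix m assume m: "m \<in> high_degree n J (Suc a)"
    then have "degree_in J m \<noteq> 0" by (simp add: high_degree_def)
    then obtain j where j: "j \<in> J" "0 < Poly_Mapping.lookup m j"
      unfolding degree_in_def by (metis sum.neutral gr0I)
    obtain w where w: "m = w + Poly_Mapping.single j 1" using remove_variable[OF j(2)] .
    have "w \<in> high_degree n J a" "Poly_Mapping.single j 1 \<in> high_degree n J 1"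
      using m j(1) w fin monomials_addD[of w "Poly_Mapping.single j 1" n]
      by (auto simp: high_degree_def degree_in_add degree_in_single)
    then have "monomial w \<otimes>\<^bsub>?S\<^esub> monomial (Poly_Mapping.single j 1) \<in> ideal_prod ?S (?V a) (?V 1)"
      by (intro ideal_prod.prod) auto
    then show "monomial m \<in> ideal_prod ?S (?V a) (?V 1)"
      by (simp add: poly_ring_def monomial_def mult_single w)
  qed
  ultimately show ?case unfolding step by blast
qed

section \<open>Exchanging variables\<close>

lemma degree_in_exchange:
  assumes J: "finite J" and y: "0 < Poly_Mapping.lookup v y" and xy: "y \<in> J \<Longrightarrow> x \<in> J"
  shows "degree_in J v \<le> degree_in J (Poly_Mapping.single x 1 + (v - Poly_Mapping.single y 1))"
proof -
  obtain w where w: "v = w + Poly_Mapping.single y 1" "w = v - Poly_Mapping.single y 1"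
    using remove_variable[OF y] .
  have "degree_in J v = degree_in J w + (if y \<in> J then 1 else 0)"
    unfolding w(1) by (simp add: degree_in_add degree_in_single[OF J])
  then show ?thesis
    using xy by (auto simp: degree_in_add degree_in_single[OF J] simp del: One_nat_def simp flip: w(2))
qed

text \<open>
  Used when \<open>degree_in J u\<close> is the least degree allowed, so that any \<open>v\<close> in the ideal satisfies
  the inequality \<open>tight\<close>.
\<close>

lemma larger_exponent_in_tight_set:
  assumes J: "finite J" "x \<in> J" and lt: "Poly_Mapping.lookup v x < Poly_Mapping.lookup u x"
    and tight: "degree_in J u \<le> degree_in J v"
  shows "\<exists>y\<in>J. Poly_Mapping.lookup u y < Poly_Mapping.lookup v y"
proof (rule ccontr)
  assume "\<not> ?thesis"
  then have "degree_in J v < degree_in J u"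
    unfolding degree_in_def using J lt by (intro sum_strict_mono_ex1) (auto simp: not_less)
  with tight show False by simp
qed

text \<open>
  Variables of smaller rank come first in the order. Since \<open>J1\<close> and \<open>J3\<close> are disjoint, rank
  \<open>2\<close> means lying in at most one of the three sets.
\<close>

definition overlap_rank :: "nat set \<Rightarrow> nat set \<Rightarrow> nat set \<Rightarrow> nat \<Rightarrow> nat" where
  "overlap_rank J1 J2 J3 x = (if x \<in> J1 \<inter> J2 then 0 else if x \<in> J2 \<inter> J3 then 1 else 2)"

text \<open>
  Here \<open>x\<close> is the first variable at which \<open>u\<close> and \<open>v\<close> differ and \<open>L\<close> is the set of variables after
  \<open>x\<close>. The rank forces a later \<open>y\<close> in a tight set containing \<open>x\<close> to lie in no further set that
  misses \<open>x\<close>: if \<open>x\<close> has rank \<open>2\<close>, so does \<open>y\<close>; if \<open>x \<in> J2 \<inter> J3\<close>, then \<open>y\<close> avoids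
  \<open>J1 \<inter> J2\<close>; if \<open>x \<in> J1 \<inter> J2\<close>, then \<open>y \<in> J1\<close> already keeps \<open>y\<close> out of \<open>J3\<close>. This leaves the
  case where \<open>x \<in> J1 \<inter> J2\<close> and \<open>J1\<close> is not tight.
\<close>

lemma exchange_variable_exists:
  fixes u v :: "nat \<Rightarrow>\<^sub>0 nat"
  assumes fin: "finite J1" "finite J2" "finite J3" and disj: "J1 \<inter> J3 = {}" and a: "a2 \<le> a1"
    and v: "a1 \<le> degree_in J1 v" "a2 \<le> degree_in J2 v" "a3 \<le> degree_in J3 v"
    and tight: "x \<in> J1 \<and> degree_in J1 u = a1 \<or> x \<in> J2 \<and> degree_in J2 u = a2
              \<or> x \<in> J3 \<and> degree_in J3 u = a3"
    and lt: "Poly_Mapping.lookup v x < Poly_Mapping.lookup u x"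
    and later: "\<And>y. y \<in> J1 \<union> J2 \<union> J3 \<Longrightarrow> y \<in> L \<Longrightarrow> overlap_rank J1 J2 J3 x \<le> overlap_rank J1 J2 J3 y"
    and earlier: "\<And>y. y \<in> J1 \<union> J2 \<union> J3 \<Longrightarrow> y \<notin> L \<Longrightarrow> y \<noteq> x \<Longrightarrow>
         Poly_Mapping.lookup u y = Poly_Mapping.lookup v y \<and>
         overlap_rank J1 J2 J3 y \<le> overlap_rank J1 J2 J3 x"
  shows "\<exists>y\<in>L. 0 < Poly_Mapping.lookup v y \<and> (\<forall>J\<in>{J1, J2, J3}. y \<in> J \<longrightarrow> x \<in> J)"
proof (cases "x \<in> J1 \<inter> J2 \<and> degree_in J1 u \<noteq> a1")
  case False
  \<comment> \<open>A tight set through \<open>x\<close>; if \<open>x \<in> J1 \<inter> J2\<close>, it can be taken to be \<open>J1\<close>.\<close>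
  have "\<exists>J\<in>{J1, J2, J3}. x \<in> J \<and> degree_in J u \<le> degree_in J v \<and> (x \<in> J1 \<inter> J2 \<longrightarrow> J = J1)"
  proof (cases "x \<in> J1 \<and> degree_in J1 u = a1")
    case True
    then show ?thesis using v by simp
  next
    case nJ1: False
    then have "x \<notin> J1 \<inter> J2" using False by blast
    then show ?thesis using nJ1 tight v by auto
  qed
  then obtain J where J: "J \<in> {J1, J2, J3}" "x \<in> J" "degree_in J u \<le> degree_in J v"
    and J1: "x \<in> J1 \<inter> J2 \<Longrightarrow> J = J1"
    by blast
  have "finite J" using J fin by blast
  from larger_exponent_in_tight_set[OF this J(2) lt J(3)]
  obtain y where y: "y \<in> J" "Poly_Mapping.lookup u y < Poly_Mapping.lookup v y" by blast
  have L: "y \<in> L" using earlier[of y] J(1) y lt by (cases "y = x") auto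
  then have "overlap_rank J1 J2 J3 x \<le> overlap_rank J1 J2 J3 y"
    using later[of y] J(1) y(1) by auto
  then have "\<forall>J\<in>{J1, J2, J3}. y \<in> J \<longrightarrow> x \<in> J"
    using J(1,2) J1 y(1) disj unfolding overlap_rank_def
    by (elim insertE emptyE) (auto split: if_splits)
  with L y(2) show ?thesis by (intro bexI[of _ y]) auto
next
  case True
  then have "degree_in J2 u = a2" using tight disj by auto
  have "\<exists>y\<in>L \<inter> J1. 0 < Poly_Mapping.lookup v y"
  proof (rule ccontr)
    assume none: "\<not> ?thesis"
    \<comment> \<open>The variables of \<open>J1\<close> dividing \<open>v\<close> are then not after \<open>x\<close>, hence of rank \<open>0\<close>, hence in \<open>J2\<close>.\<close>
    have rank: "overlap_rank J1 J2 J3 x = 0" using True by (simp add: overlap_rank_def)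
    have out: "y \<in> J2 \<and> Poly_Mapping.lookup v y \<le> Poly_Mapping.lookup u y"
      if "y \<in> J1" "Poly_Mapping.lookup v y \<noteq> 0" for y
    proof (cases "y = x")
      case False
      then have "overlap_rank J1 J2 J3 y \<le> 0" "Poly_Mapping.lookup u y = Poly_Mapping.lookup v y"
        using earlier[of y] that False none unfolding rank by blast+
      then show ?thesis by (auto simp: overlap_rank_def split: if_splits)
    qed (use True lt in auto)
    have "degree_in J1 v = degree_in (J1 \<inter> J2) v"
      unfolding degree_in_def using fin out by (intro sum.mono_neutral_right) auto
    also have "\<dots> < degree_in (J1 \<inter> J2) u"
      unfolding degree_in_def
    proof (rule sum_strict_mono_ex1)
      show "\<forall>y\<in>J1 \<inter> J2. Poly_Mapping.lookup v y \<le> Poly_Mapping.lookup u y"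
        using out by fastforce
    qed (use fin True lt in auto)
    also have "\<dots> \<le> degree_in J2 u"
      unfolding degree_in_def using fin by (intro sum_mono2) auto
    finally show False using v(1) a \<open>degree_in J2 u = a2\<close> by simp
  qed
  then obtain y where "y \<in> L" "y \<in> J1" "0 < Poly_Mapping.lookup v y" by blast
  then show ?thesis using True disj by (intro bexI[of _ y]) auto
qed

lemma ex_bij_betw_mono_rank:
  fixes r :: "nat \<Rightarrow> nat"
  shows "\<exists>i. bij_betw i {1..n} {1..n} \<and> (\<forall>k\<in>{1..n}. \<forall>l\<in>{1..n}. k \<le> l \<longrightarrow> r (i k) \<le> r (i l))"
proof -
  \<comment> \<open>Positions are counted from \<open>1\<close>, list indices from \<open>0\<close>.\<close>
  define xs where "xs = sort_key r [1..<Suc n]"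
  have xs: "distinct xs" "set xs = {1..n}" "length xs = n" "sorted (map r xs)"
    by (auto simp: xs_def)
  have "bij_betw (\<lambda>k. k - 1) {1..n} {..<n}"
    by (rule bij_betw_byWitness[where f' = Suc]) auto
  moreover have "bij_betw (\<lambda>k. xs ! k) {..<n} {1..n}"
    using bij_betw_nth[OF xs(1)] xs(2,3) by simp
  ultimately have "bij_betw (\<lambda>k. xs ! (k - 1)) {1..n} {1..n}"
    using bij_betw_trans by (fastforce simp: o_def)
  moreover have "r (xs ! (k - 1)) \<le> r (xs ! (l - 1))" if "k \<in> {1..n}" "l \<in> {1..n}" "k \<le> l" for k l
    using sorted_nth_mono[OF xs(4), of "k - 1" "l - 1"] that xs(3) by auto
  ultimately show ?thesis by blast
qed

theorem theorem2p6:
  fixes n :: nat and J1 J2 J3 :: "nat set" and a1 a2 a3 :: nat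
    and I :: "('k::field) mpoly set"
  assumes "J1 \<subseteq> {1..n}" and "J2 \<subseteq> {1..n}" and "J3 \<subseteq> {1..n}"
    and "J1 \<inter> J3 = {}"
    and "a1 \<ge> a2" and "a2 \<ge> a3" and "a3 > 0"
    and "I = ideal_power n (var_ideal n J1) a1 \<inter> ideal_power n (var_ideal n J2) a2
               \<inter> ideal_power n (var_ideal n J3) a3"
  shows "\<exists>i. bij_betw i {1..n} {1..n} \<and> weakly_polymatroidal n i I"
proof -
  note J = assms(1-3)
  have fin: "finite J1" "finite J2" "finite J3" using J finite_subset by blast+
  define U where "U = high_degree n J1 a1 \<inter> high_degree n J2 a2 \<inter> high_degree n J3 a3"
  have I: "I = monomial_span U"
    unfolding assms(8) ideal_power_var_ideal[OF J(1)] ideal_power_var_ideal[OF J(2)]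
      ideal_power_var_ideal[OF J(3)] U_def by (auto simp: monomial_span_def)
  have U: "monomial_filter n U"
    using monomial_filter_high_degree unfolding U_def monomial_filter_def by blast
  have U_iff: "u \<in> U \<longleftrightarrow> u \<in> monomials n \<and> a1 \<le> degree_in J1 u \<and> a2 \<le> degree_in J2 u \<and> a3 \<le> degree_in J3 u"
    for u by (auto simp: U_def high_degree_def)
  let ?r = "overlap_rank J1 J2 J3"
  obtain i where bij: "bij_betw i {1..n} {1..n}"
    and mono: "\<And>k l. k \<in> {1..n} \<Longrightarrow> l \<in> {1..n} \<Longrightarrow> k \<le> l \<Longrightarrow> ?r (i k) \<le> ?r (i l)"
    using ex_bij_betw_mono_rank[of n ?r] by blast
  have "\<exists>j\<in>{t<..n}. 0 < Poly_Mapping.lookup v (i j) \<and>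
           var (i t) * monomial (v - Poly_Mapping.single (i j) 1) \<in> I"
    if u: "u \<in> min_gens n I" and v: "v \<in> min_gens n I" and lex: "lex_gt_at n i t u v" for u v t
  proof -
    let ?x = "i t"
    have t: "t \<in> {1..n}" and lt: "Poly_Mapping.lookup v ?x < Poly_Mapping.lookup u ?x"
      and eq: "\<And>k. k \<in> {1..<t} \<Longrightarrow> Poly_Mapping.lookup u (i k) = Poly_Mapping.lookup v (i k)"
      using lex by (auto simp: lex_gt_at_def)
    have vU: "v \<in> U" and uU: "u \<in> U"
      using min_gens_minimal(1)[OF U] u v by (auto simp: I)
    obtain w where w: "u = w + Poly_Mapping.single ?x 1" "w = u - Poly_Mapping.single ?x 1"
      using remove_variable[of u ?x] lt by auto
    have "w \<notin> U" using min_gens_minimal(2)[OF U, of u ?x] u lt by (simp add: I w(2))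
    moreover have "w \<in> monomials n" using uU w(1) monomials_addD unfolding U_iff by blast
    \<comment> \<open>Dividing \<open>u\<close> by \<open>x\<close> leaves the ideal, so it violates an inequality that \<open>u\<close> satisfies.\<close>
    ultimately have tight: "?x \<in> J1 \<and> degree_in J1 u = a1 \<or> ?x \<in> J2 \<and> degree_in J2 u = a2
        \<or> ?x \<in> J3 \<and> degree_in J3 u = a3"
      using uU fin unfolding U_iff w(1) by (auto simp: degree_in_add degree_in_single split: if_splits)
    have pos: "\<exists>k\<in>{1..n}. y = i k" if "y \<in> J1 \<union> J2 \<union> J3" for y
      using that J bij by (auto simp: bij_betw_def)
    obtain y where y: "y \<in> i ` {t<..n}" "0 < Poly_Mapping.lookup v y"
      "\<forall>J\<in>{J1, J2, J3}. y \<in> J \<longrightarrow> ?x \<in> J"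
    proof -
      have "\<exists>y\<in>i ` {t<..n}. 0 < Poly_Mapping.lookup v y \<and> (\<forall>J\<in>{J1, J2, J3}. y \<in> J \<longrightarrow> ?x \<in> J)"
      proof (rule exchange_variable_exists[OF fin assms(4,5) _ _ _ tight lt])
        fix y assume "y \<in> i ` {t<..n}"
        then show "?r ?x \<le> ?r y" using mono t by auto
      next
        fix y assume "y \<in> J1 \<union> J2 \<union> J3" and nL: "y \<notin> i ` {t<..n}" and "y \<noteq> ?x"
        then obtain k where k: "k \<in> {1..n}" "y = i k" using pos by blast
        then have "k < t" using nL \<open>y \<noteq> ?x\<close> by (metis atLeastAtMost_iff greaterThanAtMost_iff image_eqI linorder_neqE_nat)
        then show "Poly_Mapping.lookup u y = Poly_Mapping.lookup v y \<and> ?r y \<le> ?r ?x"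
          using eq[of k] mono[of k t] k t by auto
      qed (use vU in \<open>auto simp: U_iff\<close>)
      then show ?thesis using that by blast
    qed
    then obtain j where j: "j \<in> {t<..n}" "y = i j" by blast
    let ?v = "Poly_Mapping.single ?x 1 + (v - Poly_Mapping.single y 1)"
    obtain w' where "v = w' + Poly_Mapping.single y 1" "w' = v - Poly_Mapping.single y 1"
      using remove_variable[OF y(2)] .
    then have "v - Poly_Mapping.single y 1 \<in> monomials n"
      using vU monomials_addD unfolding U_iff by metis
    moreover have "Poly_Mapping.single ?x 1 \<in> monomials n"
      using t bij by (auto simp: monomials_def bij_betw_def)
    ultimately have "?v \<in> monomials n" by (intro monomials_add)
    moreover have "degree_in J v \<le> degree_in J ?v" if "J \<in> {J1, J2, J3}" for J
      using that y(3) fin by (intro degree_in_exchange[OF _ y(2)]) auto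
    ultimately have "?v \<in> U"
      using vU unfolding U_iff by (meson insertCI le_trans)
    moreover have "var ?x * monomial (v - Poly_Mapping.single y 1) = (monomial ?v :: 'k mpoly)"
      by (simp add: var_def monomial_def mult_single)
    ultimately show ?thesis using j y(2) by (intro bexI[of _ j]) (auto simp: I)
  qed
  then have "weakly_polymatroidal n i I"
    unfolding weakly_polymatroidal_def using monomial_ideal_span[OF U] by (auto simp: I)
  with bij show ?thesis by blast
qed

end
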